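(* Let $W$ be a (finite) Weyl group (not necessarily simple), and let $\Lambda_a$ be the root lattice of $W$. Then for any vector $v\in\mathbb{R}\Lambda_a$, the group $$W^{v+\Lambda_a}:=\{\rho\in W : \rho(v)-v\in\Lambda_a\}$$ is the Weyl group generated by the roots of $W$ it contains; that is, it is generated by those reflections $s_r$, $r$ a root of $W$, that belong to $W^{v+\Lambda_a}$.
   Context: A finite Weyl group $W$ is the group generated by the orthogonal reflections $s_r$ in the roots $r$ of a (reduced, crystallographic, possibly reducible) root system in a Euclidean space. The root lattice $\Lambda_a$ is the $\mathbb{Z}$-span of the roots, and $\mathbb{R}\Lambda_a$ its real span, on which $W$ acts. *)

theory Defs
  imports "HOL-Analysis.Analysis" "HOL-Algebra.Bij" "HOL-Algebra.Generated_Groups"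
begin

definition root_reflection :: "'a::euclidean_space \<Rightarrow> 'a \<Rightarrow> 'a"
  where "root_reflection r x = x - (2 * (x \<bullet> r) / (r \<bullet> r)) *\<^sub>R r"

(* Reduced, crystallographic, possibly reducible (possibly empty).
   The roots are not required to span the ambient Euclidean space. *)
definition root_system :: "'a::euclidean_space set \<Rightarrow> bool"
  where "root_system R \<longleftrightarrow>
    finite R \<and> 0 \<notin> R \<and>
    (\<forall>r\<in>R. root_reflection r ` R = R) \<and>
    (\<forall>r\<in>R. \<forall>s\<in>R. 2 * (s \<bullet> r) / (r \<bullet> r) \<in> \<int>) \<and>
    (\<forall>r\<in>R. span {r} \<inter> R = {r, - r})"

(* Elements are maps of the whole ambient space; they fix the orthogonal complement of
   the roots pointwise, so this is the same group as the one acting on the span of R. *)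
definition weyl_group :: "'a::euclidean_space set \<Rightarrow> ('a \<Rightarrow> 'a) set"
  where "weyl_group R = generate (BijGroup UNIV) (root_reflection ` R)"

lemma module_of_int_scaleR:
  "module (\<lambda>(n::int) (x::'a::real_vector). of_int n *\<^sub>R x)"
  by unfold_locales (simp_all add: algebra_simps)

definition root_lattice :: "'a::euclidean_space set \<Rightarrow> 'a set"
  where "root_lattice R = module.span (\<lambda>(n::int) x. of_int n *\<^sub>R x) R"

definition weyl_coset_stabilizer :: "'a::euclidean_space set \<Rightarrow> 'a \<Rightarrow> ('a \<Rightarrow> 'a) set"
  where "weyl_coset_stabilizer R v = {\<rho> \<in> weyl_group R. \<rho> v - v \<in> root_lattice R}"

end

theory Submission
  imports Defs
begin

text \<open>
  An element \<open>\<rho>\<close> of the Weyl group with \<open>\<rho> v - v\<close> in the root lattice is the linear part of the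
  map \<open>x \<mapsto> \<rho> x + (v - \<rho> v)\<close>, which fixes \<open>v\<close> and belongs to the affine reflection group generated by
  the Weyl group and the translations by the root lattice. In a group generated by a locally finite,
  conjugation invariant set of affine reflections, the stabilizer of a point \<open>v\<close> is generated by
  the reflections fixing \<open>v\<close>: fix a base chamber having \<open>v\<close> in its closure and write an element of
  the stabilizer as a reduced word in the reflections in the walls of this chamber; the hyperplane
  of the first letter separates the chamber from its image, and as \<open>v\<close> is in the closure of both,
  the first letter fixes \<open>v\<close>.
\<close>

section \<open>Words\<close>

text \<open>Words need no inverse letters because the generators considered later are involutions.
  The exact length \<open>n\<close> is kept, since \<open>exchange\<close> shortens words and the
  stabilizer argument inducts on length.\<close>

primrec products :: "('a \<Rightarrow> 'a) set \<Rightarrow> nat \<Rightarrow> ('a \<Rightarrow> 'a) set" where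
  "products S 0 = {id}"
| "products S (Suc n) = {s \<circ> g | s g. s \<in> S \<and> g \<in> products S n}"

definition product_closure :: "('a \<Rightarrow> 'a) set \<Rightarrow> ('a \<Rightarrow> 'a) set" where
  "product_closure S = (\<Union>n. products S n)"

lemma id_in_product_closure: "id \<in> product_closure S"
  unfolding product_closure_def by (auto intro: exI[of _ 0])

lemma comp_in_product_closure:
  assumes "s \<in> S" "g \<in> product_closure S"
  shows "s \<circ> g \<in> product_closure S"
proof -
  from assms obtain n where "g \<in> products S n"
    by (auto simp: product_closure_def)
  then have "s \<circ> g \<in> products S (Suc n)"
    using assms by auto
  then show ?thesis
    unfolding product_closure_def by blast
qed

lemma product_closure_induct [consumes 1, case_names id comp]:
  assumes "g \<in> product_closure S" "P id"
    and "\<And>s g. s \<in> S \<Longrightarrow> g \<in> product_closure S \<Longrightarrow> P g \<Longrightarrow> P (s \<circ> g)"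
  shows "P g"
proof -
  have "g \<in> products S n \<Longrightarrow> P g" for n
  proof (induction n arbitrary: g)
    case (Suc n)
    then show ?case
      using assms(3) by (auto simp: product_closure_def)
  qed (use assms(2) in simp)
  then show ?thesis
    using assms(1) by (auto simp: product_closure_def)
qed

lemma incl_product_closure: "s \<in> S \<Longrightarrow> s \<in> product_closure S"
  using comp_in_product_closure[OF _ id_in_product_closure] by fastforce

lemma product_closure_comp:
  assumes "g \<in> product_closure S" "h \<in> product_closure S"
  shows "g \<circ> h \<in> product_closure S"
  using assms
  by (induction rule: product_closure_induct) (auto simp: comp_assoc intro: comp_in_product_closure)

lemma product_closure_subset:
  assumes "S \<subseteq> product_closure S'"
  shows "product_closure S \<subseteq> product_closure S'"
proof
  fix g assume "g \<in> product_closure S"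
  then show "g \<in> product_closure S'"
  proof (induction rule: product_closure_induct)
    case (comp s g)
    then show ?case
      using assms product_closure_comp by blast
  qed (rule id_in_product_closure)
qed

section \<open>Affine reflections\<close>

definition affine_reflection :: "'a::euclidean_space \<Rightarrow> real \<Rightarrow> 'a \<Rightarrow> 'a" where
  "affine_reflection u c x = x - (2 * (x \<bullet> u - c)) *\<^sub>R u"

text \<open>For a reflection \<open>t\<close> this says that \<open>p\<close> and \<open>q\<close>
  lie strictly on opposite sides of the mirror. The metric form needs no normal vector, which is
  determined only up to sign, and is visibly invariant under isometries.\<close>

definition separates :: "('a::metric_space \<Rightarrow> 'a) \<Rightarrow> 'a \<Rightarrow> 'a \<Rightarrow> bool" where
  "separates t p q \<longleftrightarrow> dist (t p) q < dist p q"

lemma affine_reflection_uminus: "affine_reflection (- u) (- c) = affine_reflection u c"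
  by (simp add: affine_reflection_def fun_eq_iff algebra_simps)

lemma affine_reflection_inner:
  "affine_reflection u c x \<bullet> w - e = (x \<bullet> w - e) - 2 * (u \<bullet> w) * (x \<bullet> u - c)"
  by (simp add: affine_reflection_def inner_diff_left)

context
  fixes u :: "'a::euclidean_space"
  assumes unit: "norm u = 1"
begin

lemma unit_inner_self: "u \<bullet> u = 1"
  using unit by (simp add: norm_eq_1)

lemma affine_reflection_involution: "affine_reflection u c (affine_reflection u c x) = x"
  by (simp add: affine_reflection_def inner_diff_left unit_inner_self algebra_simps)

lemma dist_affine_reflection_sq:
  "(dist (affine_reflection u c x) y)\<^sup>2 = (dist x y)\<^sup>2 + 4 * ((x \<bullet> u - c) * (y \<bullet> u - c))"
  unfolding dist_norm power2_norm_eq_inner affine_reflection_def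
  by (simp add: inner_diff_left inner_diff_right unit_inner_self inner_commute algebra_simps)

lemma dist_affine_reflection_self: "dist x (affine_reflection u c x) = 2 * \<bar>x \<bullet> u - c\<bar>"
  unfolding affine_reflection_def dist_norm
  by (simp only: diff_diff_eq2 add_diff_cancel_left' norm_scaleR unit abs_mult mult_1_right abs_numeral)

text \<open>Reflecting one point and then the other changes the squared distance by two opposite
  amounts, since reflecting \<open>y\<close> flips the sign of its offset from the mirror.\<close>

lemma affine_reflection_isometry:
  "dist (affine_reflection u c x) (affine_reflection u c y) = dist x y"
proof -
  have "(dist (affine_reflection u c x) (affine_reflection u c y))\<^sup>2 = (dist x y)\<^sup>2"
    using dist_affine_reflection_sq[of c x "affine_reflection u c y"]
      dist_affine_reflection_sq[of c y x] affine_reflection_inner[of u c y u c]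
    by (simp add: unit_inner_self dist_commute algebra_simps)
  then show ?thesis
    by (simp add: power2_eq_iff_nonneg)
qed

lemma separates_affine_reflection_iff:
  "separates (affine_reflection u c) p q \<longleftrightarrow> (p \<bullet> u - c) * (q \<bullet> u - c) < 0"
proof -
  have "separates (affine_reflection u c) p q \<longleftrightarrow> (dist (affine_reflection u c p) q)\<^sup>2 < (dist p q)\<^sup>2"
    unfolding separates_def by (simp add: power_mono_iff flip: not_le)
  then show ?thesis
    unfolding dist_affine_reflection_sq by simp
qed

lemma affine_reflection_fixed_iff: "affine_reflection u c x = x \<longleftrightarrow> x \<bullet> u = c"
  using unit by (auto simp: affine_reflection_def)

end

section \<open>Locally finite sets of reflections\<close>

text \<open>As \<open>dist x (t x)\<close> is twice the distance from \<open>x\<close> to the mirror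
  of \<open>t\<close>, the last axiom says that each ball meets only finitely many mirrors.\<close>

locale reflection_arrangement =
  fixes T :: "('a::euclidean_space \<Rightarrow> 'a) set"
  assumes reflection: "t \<in> T \<Longrightarrow> \<exists>u c. norm u = 1 \<and> t = affine_reflection u c"
    and conjugate: "s \<in> T \<Longrightarrow> t \<in> T \<Longrightarrow> s \<circ> t \<circ> s \<in> T"
    and locally_finite: "finite {t \<in> T. dist x (t x) \<le> d}"
begin

lemma involution: "t \<in> T \<Longrightarrow> t (t x) = x"
  using reflection affine_reflection_involution by metis

lemma isometry: "t \<in> T \<Longrightarrow> dist (t x) (t y) = dist x y"
  using reflection affine_reflection_isometry by metis

lemma separates_image_iff:
  assumes "s \<in> T"
  shows "separates t (s p) (s q) \<longleftrightarrow> separates (s \<circ> t \<circ> s) p q"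
  using isometry[OF assms, of "t (s p)" "s q"] involution[OF assms] isometry[OF assms, of p q]
  by (simp add: separates_def)

lemma conjugate_conjugate: "s \<in> T \<Longrightarrow> s \<circ> (s \<circ> t \<circ> s) \<circ> s = t"
  by (auto simp: involution)

text \<open>A mirror separating \<open>p\<close> from \<open>q\<close> moves \<open>p\<close> by
  less than \<open>2 * dist p q\<close>, by the triangle inequality through
  \<open>q\<close>.\<close>

lemma finite_separating: "finite {t \<in> T. separates t p q}"
proof (rule finite_subset[OF _ locally_finite])
  show "{t \<in> T. separates t p q} \<subseteq> {t \<in> T. dist p (t p) \<le> 2 * dist p q}"
  proof clarify
    fix t assume "separates t p q"
    then show "dist p (t p) \<le> 2 * dist p q"
      using dist_triangle[of p "t p" q] by (simp add: separates_def dist_commute)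
  qed
qed

text \<open>A point off all mirrors stands for the chamber containing it; chambers are never formed
  as sets.\<close>

definition generic :: "'a \<Rightarrow> bool" where
  "generic p \<longleftrightarrow> (\<forall>t\<in>T. t p \<noteq> p)"

lemma generic_image:
  assumes "s \<in> T" "generic p"
  shows "generic (s p)"
  unfolding generic_def
proof clarify
  fix t assume "t \<in> T" "t (s p) = s p"
  then have "s \<circ> t \<circ> s \<in> T" "(s \<circ> t \<circ> s) p = p"
    using assms conjugate by (auto simp: involution)
  then show False
    using assms by (auto simp: generic_def)
qed

lemma generic_closure_image:
  assumes "g \<in> product_closure T" "generic p"
  shows "generic (g p)"
  using assms by (induction rule: product_closure_induct) (auto intro: generic_image)

lemma oriented_reflection:
  assumes "t \<in> T" "generic p"
  obtains u c where "norm u = 1" "t = affine_reflection u c" "p \<bullet> u - c > 0"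
proof -
  obtain u c where *: "norm u = 1" "t = affine_reflection u c"
    using reflection assms by blast
  have "p \<bullet> u \<noteq> c"
    using assms *(2) affine_reflection_fixed_iff[OF *(1), of c] unfolding generic_def by blast
  then consider "p \<bullet> u - c > 0" | "p \<bullet> (- u) - (- c) > 0"
    by (fastforce simp: algebra_simps)
  then show ?thesis
    using * that affine_reflection_uminus by (metis norm_minus_cancel)
qed

text \<open>Each of the three points has a nonzero sign with respect to the mirror of
  \<open>t\<close>, and separation compares two signs.\<close>

lemma separates_cocycle:
  assumes "t \<in> T" "generic p" "generic q" "generic r"
  shows "separates t p r \<longleftrightarrow> separates t p q \<noteq> separates t q r"
proof -
  obtain u c where *: "norm u = 1" "t = affine_reflection u c" "p \<bullet> u - c > 0"
    using oriented_reflection assms(1,2) by blast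
  have "q \<bullet> u \<noteq> c" "r \<bullet> u \<noteq> c"
    using assms(1,3,4) *(2) affine_reflection_fixed_iff[OF *(1), of c]
    unfolding generic_def by blast+
  then have "q \<bullet> u - c \<noteq> 0" "r \<bullet> u - c \<noteq> 0"
    by simp_all
  with *(3) show ?thesis
    unfolding *(2) separates_affine_reflection_iff[OF *(1)] mult_less_0_iff by argo
qed

text \<open>Local finiteness around 0 makes \<open>T\<close> countable, and countably many
  hyperplanes, being negligible, cannot cover a ball.\<close>

lemma exists_generic:
  assumes "d > 0"
  obtains p where "generic p" "dist p v < d"
proof -
  have "\<exists>n. dist 0 (t 0) \<le> real n" for t :: "'a \<Rightarrow> 'a"
    by (rule real_arch_simple)
  then have T: "T = (\<Union>n. {t \<in> T. dist 0 (t 0) \<le> real n})"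
    by (auto simp: set_eq_iff)
  have "countable (\<Union>n. {t \<in> T. dist 0 (t 0) \<le> real n})"
    by (rule countable_UN[OF _ countable_finite[OF locally_finite]]) simp
  then have "countable T"
    using T by metis
  have "negligible {x. t x = x}" if t: "t \<in> T" for t
  proof -
    obtain u c where *: "norm u = 1" "t = affine_reflection u c"
      using reflection t by blast
    have "{x. t x = x} = {x. u \<bullet> x = c}"
      using affine_reflection_fixed_iff[OF *(1)] *(2) by (auto simp: inner_commute)
    moreover have "u \<noteq> 0"
      using *(1) by auto
    ultimately show ?thesis
      using negligible_hyperplane by metis
  qed
  then have "negligible (\<Union>t\<in>T. {x. t x = x})"
    using \<open>countable T\<close> negligible_countable_Union[of "(\<lambda>t. {x. t x = x}) ` T"] by blast
  moreover have "\<not> negligible (ball v d)"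
    using assms open_not_negligible[of "ball v d"] by simp
  ultimately have "\<not> ball v d \<subseteq> (\<Union>t\<in>T. {x. t x = x})"
    using negligible_subset by blast
  then obtain p where "p \<in> ball v d" "\<forall>t\<in>T. t p \<noteq> p"
    by blast
  then show ?thesis
    using that[of p] by (simp add: generic_def dist_commute)
qed

end

section \<open>Wall reflections of a base chamber and the exchange property\<close>

locale based_reflection_arrangement = reflection_arrangement T
  for T :: "('a::euclidean_space \<Rightarrow> 'a) set" +
  fixes p :: 'a
  assumes generic_base: "generic p"
begin

text \<open>These are the reflections in the walls of the chamber of \<open>p\<close>: passing from
  \<open>p\<close> to \<open>s p\<close> crosses the mirror of \<open>s\<close> and no
  other.\<close>

definition simple :: "('a \<Rightarrow> 'a) set" where
  "simple = {s \<in> T. \<forall>t\<in>T. separates t p (s p) \<longleftrightarrow> t = s}"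

lemma simple_subset: "simple \<subseteq> T"
  by (auto simp: simple_def)

lemma simple_closure_subset: "product_closure simple \<subseteq> product_closure T"
  using product_closure_subset simple_subset incl_product_closure by (metis subsetD subsetI)

lemma separates_self:
  assumes "s \<in> T"
  shows "separates s p (s p)"
  using assms generic_base by (auto simp: separates_def generic_def)

(* Take the first hyperplane crossed on the way from p to q, and among those crossed
   simultaneously the one closest to p. *)
lemma exists_simple_separating:
  assumes "generic q" "t0 \<in> T" "separates t0 p q"
  shows "\<exists>s\<in>simple. separates s p q"
proof -
  define N where "N = {t \<in> T. separates t p q}"
  \<comment> \<open>The segment from \<open>p\<close> to \<open>q\<close> meets a separating mirror
    at parameter \<open>1 / (1 + \<kappa> t)\<close>, so the largest ratio belongs to the mirrors
    crossed first.\<close>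
  define \<kappa> where "\<kappa> t = dist q (t q) / dist p (t p)" for t
  define M where "M = {t \<in> N. \<kappa> t = Max (\<kappa> ` N)}"
  have N: "finite N" "N \<noteq> {}"
    using finite_separating assms by (auto simp: N_def)
  then obtain t where "t \<in> N" "Max (\<kappa> ` N) = \<kappa> t"
    using Max_in[of "\<kappa> ` N"] by blast
  then have M: "finite M" "M \<noteq> {}"
    using N by (auto simp: M_def)
  then obtain s where "s \<in> M" and closest: "\<And>t. t \<in> M \<Longrightarrow> dist p (s p) \<le> dist p (t p)"
    using ex_min_if_finite[of "(\<lambda>t. dist p (t p)) ` M"] by (force simp: not_less)
  then have s: "s \<in> T" "separates s p q" and first: "\<And>t. t \<in> N \<Longrightarrow> \<kappa> t \<le> \<kappa> s"
    using N by (auto simp: M_def N_def)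
  obtain u c where u: "norm u = 1" "s = affine_reflection u c" "p \<bullet> u - c > 0"
    using oriented_reflection s generic_base by blast
  define a where "a = p \<bullet> u - c"
  have "a > 0" "q \<bullet> u - c < 0"
    using u s separates_affine_reflection_iff[OF u(1)] by (auto simp: a_def mult_less_0_iff)
  define k where "k = \<kappa> s"
  have "k = (2 * \<bar>q \<bullet> u - c\<bar>) / (2 * \<bar>p \<bullet> u - c\<bar>)"
    unfolding k_def \<kappa>_def u(2) dist_affine_reflection_self[OF u(1)] ..
  also have "\<dots> = \<bar>q \<bullet> u - c\<bar> / \<bar>a\<bar>"
    unfolding a_def by (rule mult_divide_mult_cancel_left) simp
  finally have "k = - (q \<bullet> u - c) / a"
    using \<open>a > 0\<close> \<open>q \<bullet> u - c < 0\<close> by simp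
  then have "k > 0" and qs: "q \<bullet> u - c = - k * a"
    using \<open>a > 0\<close> \<open>q \<bullet> u - c < 0\<close> by (simp_all add: divide_neg_pos)
  \<comment> \<open>The segment crosses the mirror of \<open>s\<close> at
    \<open>(q + k p) / (1 + k)\<close>. The bound says that this point is on the closed
    \<open>p\<close>-side of every mirror; equality means that the mirror passes through it, and
    then minimality of \<open>s\<close> applies.\<close>
  have bound: "q \<bullet> w - e \<ge> - k * (p \<bullet> w - e)"
    and tie: "q \<bullet> w - e = - k * (p \<bullet> w - e) \<Longrightarrow> a \<le> p \<bullet> w - e"
    if "t \<in> T" "norm w = 1" "t = affine_reflection w e" "p \<bullet> w - e > 0" for t w e
  proof -
    have "\<kappa> t = (2 * \<bar>q \<bullet> w - e\<bar>) / (2 * \<bar>p \<bullet> w - e\<bar>)"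
      unfolding \<kappa>_def that(3) dist_affine_reflection_self[OF that(2)] ..
    also have "\<dots> = \<bar>q \<bullet> w - e\<bar> / \<bar>p \<bullet> w - e\<bar>"
      by (rule mult_divide_mult_cancel_left) simp
    finally have \<kappa>: "\<kappa> t * (p \<bullet> w - e) = \<bar>q \<bullet> w - e\<bar>"
      using that(4) by simp
    have in_N: "t \<in> N \<longleftrightarrow> q \<bullet> w - e < 0"
      using that separates_affine_reflection_iff[OF that(2)]
      by (auto simp: N_def mult_less_0_iff)
    show "q \<bullet> w - e \<ge> - k * (p \<bullet> w - e)"
    proof (cases "t \<in> N")
      case True
      then have "\<kappa> t * (p \<bullet> w - e) \<le> k * (p \<bullet> w - e)"
        using first that by (intro mult_right_mono) (auto simp: k_def)
      then show ?thesis
        using True in_N \<kappa> by simp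
    next
      case False
      then show ?thesis
        using in_N \<open>k > 0\<close> that(4) mult_pos_pos[of k "p \<bullet> w - e"] by linarith
    qed
    assume eq: "q \<bullet> w - e = - k * (p \<bullet> w - e)"
    then have neg: "q \<bullet> w - e < 0"
      using mult_pos_pos[OF \<open>k > 0\<close> that(4)] by linarith
    then have "\<kappa> t * (p \<bullet> w - e) = k * (p \<bullet> w - e)"
      using \<kappa> eq by linarith
    then have "\<kappa> t = k"
      using that(4) by simp
    then have "t \<in> M"
      using neg in_N \<open>s \<in> M\<close> by (auto simp: M_def k_def)
    then show "a \<le> p \<bullet> w - e"
      using closest[of t] dist_affine_reflection_self[OF that(2)]
        dist_affine_reflection_self[OF u(1)] u that by (simp add: a_def)
  qed
  have "t = s" if t: "t \<in> T" "separates t p (s p)" for t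
  proof -
    obtain w e where w: "norm w = 1" "t = affine_reflection w e" "p \<bullet> w - e > 0"
      using oriented_reflection t generic_base by blast
    define b where "b = p \<bullet> w - e"
    define m where "m = 2 * (u \<bullet> w)"
    have sp: "s p \<bullet> w - e = b - m * a"
      by (simp add: u(2) affine_reflection_inner a_def b_def m_def)
    then have "b - m * a < 0"
      using t w separates_affine_reflection_iff[OF w(1)] by (auto simp: mult_less_0_iff)
    \<comment> \<open>Up to sign this is the mirror image of \<open>w\<close> under the linear part
      of \<open>s\<close>. The sign puts \<open>p\<close> on the positive side, because
      \<open>s p\<close> is on the negative side of \<open>t\<close>.\<close>
    define w' where "w' = m *\<^sub>R u - w"
    define e' where "e' = m * c - e"
    have w': "x \<bullet> w' - e' = m * (x \<bullet> u - c) - (x \<bullet> w - e)" for x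
      by (simp add: w'_def e'_def inner_diff_right algebra_simps)
    have "s \<circ> t \<circ> s = affine_reflection w' e'"
    proof
      fix x
      define A B where "A = x \<bullet> u - c" and "B = x \<bullet> w - e"
      have sx: "s x = x - (2 * A) *\<^sub>R u" "s x \<bullet> w - e = B - m * A" "s x \<bullet> u - c = - A"
        using affine_reflection_inner[of u c x] unit_inner_self[OF u(1)]
        by (simp_all add: u(2) A_def B_def m_def affine_reflection_def)
      then have tsx: "t (s x) = x - (2 * A) *\<^sub>R u - (2 * (B - m * A)) *\<^sub>R w"
        by (simp add: w(2) affine_reflection_def)
      have "t (s x) \<bullet> u - c = (s x \<bullet> u - c) - m * (s x \<bullet> w - e)"
        by (simp add: w(2) affine_reflection_inner m_def inner_commute[of w u])
      also have "\<dots> = - A - m * (B - m * A)"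
        unfolding sx(2,3) ..
      finally have "s (t (s x)) = t (s x) - (2 * (- A - m * (B - m * A))) *\<^sub>R u"
        by (simp add: u(2) affine_reflection_def)
      also have "\<dots> = x - (2 * (m * A - B)) *\<^sub>R (m *\<^sub>R u - w)"
        unfolding tsx by (simp add: algebra_simps)
      finally show "(s \<circ> t \<circ> s) x = affine_reflection w' e' x"
        unfolding affine_reflection_def[of w' e'] w' by (simp add: w'_def A_def B_def)
    qed
    moreover have "norm w' = 1"
      using unit_inner_self[OF u(1)] unit_inner_self[OF w(1)]
      by (simp add: norm_eq_1 w'_def m_def inner_diff_left inner_diff_right inner_commute)
    moreover have "p \<bullet> w' - e' > 0"
      using \<open>b - m * a < 0\<close> by (simp add: w' a_def b_def)
    ultimately have refl': "- k * (p \<bullet> w' - e') \<le> q \<bullet> w' - e'"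
      "q \<bullet> w' - e' = - k * (p \<bullet> w' - e') \<Longrightarrow> a \<le> p \<bullet> w' - e'"
      using bound tie conjugate s t by blast+
    \<comment> \<open>The crossing point is fixed by \<open>s\<close>, so the bounds for
      \<open>t\<close> and for its conjugate are opposite inequalities there. Hence the mirror of
      \<open>t\<close> passes through the crossing point.\<close>
    have "q \<bullet> w - e \<ge> - k * b"
      using bound t w by (simp add: b_def)
    moreover have "q \<bullet> w - e \<le> - k * b"
      using refl'(1) by (simp add: w' qs a_def[symmetric] b_def[symmetric] algebra_simps)
    ultimately have qt: "q \<bullet> w - e = - k * b"
      by simp
    \<comment> \<open>Both \<open>t\<close> and its conjugate now tie with \<open>s\<close>. Adding
      the two minimality inequalities forces \<open>m \<ge> 2\<close>, and unit vectors with inner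
      product at least 1 coincide.\<close>
    then have "a \<le> b"
      using tie t w by (simp add: b_def)
    moreover have "a \<le> m * a - b"
      using refl'(2) qt by (simp add: w' qs a_def[symmetric] b_def[symmetric] algebra_simps)
    ultimately have "2 * a \<le> m * a"
      by simp
    then have "u \<bullet> w \<ge> 1"
      using \<open>a > 0\<close> by (simp add: m_def)
    then have "(u - w) \<bullet> (u - w) \<le> 0"
      using unit_inner_self[OF u(1)] unit_inner_self[OF w(1)]
      by (simp add: inner_diff_left inner_diff_right inner_commute)
    then have "u = w"
      by (metis inner_ge_zero inner_eq_zero_iff order_antisym right_minus_eq)
    \<comment> \<open>Both sides equal \<open>(p - q) \<bullet> u\<close>.\<close>
    then have "(1 + k) * a = (1 + k) * b"
      using qs qt by (simp add: a_def b_def algebra_simps)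
    then have "a = b"
      using \<open>k > 0\<close> by simp
    then show "t = s"
      using u w \<open>u = w\<close> by (simp add: a_def b_def)
  qed
  then have "s \<in> simple"
    using s separates_self by (auto simp: simple_def)
  then show ?thesis
    using s by blast
qed

text \<open>The conjugate moves \<open>p\<close> as far as \<open>t\<close> moves
  \<open>s p\<close>. Since \<open>s\<close> separates \<open>p\<close> from \<open>t p\<close>, the
  normals oriented towards \<open>p\<close> have positive inner product, so \<open>s\<close> moves
  \<open>p\<close> towards the mirror of \<open>t\<close>; simplicity of \<open>s\<close> prevents
  crossing it.\<close>

lemma closer_conjugate:
  assumes "t \<in> T" "s \<in> simple" "s \<noteq> t" "separates s p (t p)"
  shows "dist p ((s \<circ> t \<circ> s) p) < dist p (t p)"
proof -
  have s: "s \<in> T" "\<not> separates t p (s p)"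
    using assms by (auto simp: simple_def)
  obtain u c where u: "norm u = 1" "s = affine_reflection u c" "p \<bullet> u - c > 0"
    using oriented_reflection s generic_base by blast
  obtain w e where w: "norm w = 1" "t = affine_reflection w e" "p \<bullet> w - e > 0"
    using oriented_reflection assms generic_base by blast
  define m where "m = 2 * (u \<bullet> w)"
  have "t p \<bullet> u - c = (p \<bullet> u - c) - m * (p \<bullet> w - e)"
    by (simp add: w(2) affine_reflection_inner m_def inner_commute[of w u])
  moreover have "t p \<bullet> u - c < 0"
    using assms(4) u separates_affine_reflection_iff[OF u(1)] by (auto simp: mult_less_0_iff)
  ultimately have "m * (p \<bullet> w - e) > 0"
    using u by simp
  then have "m * (p \<bullet> u - c) > 0"
    using w u by (simp add: zero_less_mult_iff)
  moreover have "s p \<bullet> w - e = (p \<bullet> w - e) - m * (p \<bullet> u - c)"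
    by (simp add: u(2) affine_reflection_inner m_def)
  moreover have "s p \<bullet> w - e \<ge> 0"
    using s w separates_affine_reflection_iff[OF w(1)] by (auto simp: mult_less_0_iff not_less)
  ultimately have "\<bar>s p \<bullet> w - e\<bar> < \<bar>p \<bullet> w - e\<bar>"
    by simp
  then have "dist (s p) (t (s p)) < dist p (t p)"
    using dist_affine_reflection_self[OF w(1)] w(2) by simp
  moreover have "dist (s p) (t (s p)) = dist p (s (t (s p)))"
    using isometry[OF s(1), of p "s (t (s p))"] involution[OF s(1)] by simp
  ultimately show ?thesis
    by simp
qed

lemma reflection_in_simple_closure:
  assumes "t \<in> T"
  shows "t \<in> product_closure simple"
  using assms
\<comment> \<open>The induction is on the displacement of \<open>p\<close>, a real number; counting
  the reflections that move \<open>p\<close> no farther makes it a natural number.\<close>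
proof (induction "card {t' \<in> T. dist p (t' p) \<le> dist p (t p)}" arbitrary: t rule: less_induct)
  case less
  obtain s where s: "s \<in> simple" "separates s p (t p)"
    using exists_simple_separating separates_self generic_image less generic_base by meson
  show ?case
  proof (cases "s = t")
    case False
    define t' where "t' = s \<circ> t \<circ> s"
    have "s \<in> T" "t' \<in> T"
      using s simple_subset conjugate less by (auto simp: t'_def)
    have "dist p (t' p) < dist p (t p)"
      unfolding t'_def using closer_conjugate less s False by blast
    then have "{x \<in> T. dist p (x p) \<le> dist p (t' p)} \<subset> {x \<in> T. dist p (x p) \<le> dist p (t p)}"
      using less.prems by force
    then have "t' \<in> product_closure simple"
      using less.hyps \<open>t' \<in> T\<close> locally_finite by (meson psubset_card_mono)
    then have "s \<circ> t' \<circ> s \<in> product_closure simple"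
      using s product_closure_comp incl_product_closure by metis
    then show ?thesis
      using conjugate_conjugate[OF \<open>s \<in> T\<close>] by (simp add: t'_def)
  qed (use s incl_product_closure in blast)
qed

text \<open>Apply the cocycle rule with \<open>s p\<close> as the middle point and pull the second
  half back by \<open>s\<close>.\<close>

lemma separates_simple_comp:
  assumes "s \<in> simple" "t \<in> T" "g \<in> product_closure T"
  shows "separates t p ((s \<circ> g) p) \<longleftrightarrow> (t = s) \<noteq> separates (s \<circ> t \<circ> s) p (g p)"
proof -
  have s: "s \<in> T" "separates t p (s p) \<longleftrightarrow> t = s"
    using assms by (auto simp: simple_def)
  show ?thesis
    using separates_cocycle[of t p "s p" "s (g p)"] s assms generic_base
      generic_image generic_closure_image separates_image_iff by simp
qed

text \<open>Peel off the first letter \<open>s\<close>. If it is \<open>t\<close>, it cancels;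
  otherwise \<open>s \<circ> t \<circ> s\<close> separates \<open>p\<close> from the image of
  \<open>p\<close> under the remaining word, which it shortens by induction, and \<open>s\<close> is
  put back in front.\<close>

lemma exchange:
  assumes "t \<in> T" "g \<in> products simple n" "separates t p (g p)"
  shows "\<exists>m<n. t \<circ> g \<in> products simple m"
  using assms
proof (induction n arbitrary: t g)
  case 0
  then show ?case
    by (simp add: separates_def)
next
  case (Suc n)
  then obtain s h where g: "g = s \<circ> h" "s \<in> simple" "h \<in> products simple n"
    by auto
  then have "s \<in> T"
    using simple_subset by blast
  show ?case
  proof (cases "t = s")
    case True
    then have "t \<circ> g = h"
      by (auto simp: g involution \<open>s \<in> T\<close>)
    then show ?thesis
      using g by blast
  next
    case False
    have "h \<in> product_closure simple"
      using g unfolding product_closure_def by blast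
    then have "h \<in> product_closure T"
      using simple_closure_subset by blast
    then have "separates (s \<circ> t \<circ> s) p (h p)"
      using separates_simple_comp g Suc.prems False by metis
    then obtain m where m: "m < n" "s \<circ> t \<circ> s \<circ> h \<in> products simple m"
      using Suc.IH g conjugate Suc.prems \<open>s \<in> T\<close> by metis
    have "t \<circ> g = s \<circ> (s \<circ> t \<circ> s \<circ> h)"
      by (auto simp: g involution \<open>s \<in> T\<close>)
    moreover have "s \<circ> (s \<circ> t \<circ> s \<circ> h) \<in> products simple (Suc m)"
      using m g(2) by (simp only: products.simps) blast
    ultimately show ?thesis
      using m(1) by (metis Suc_less_eq)
  qed
qed

text \<open>The last hypothesis says that \<open>v\<close> lies in the closure of the chamber of
  \<open>p\<close>. Strong induction on the length replaces the choice of a reduced word.\<close>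

lemma stabilizer_generated_near:
  assumes "g \<in> products simple n" "g v = v"
    and "\<And>t. t \<in> T \<Longrightarrow> \<not> separates t p v"
  shows "g \<in> product_closure {t \<in> T. t v = v}"
  using assms(1,2)
proof (induction n arbitrary: g rule: less_induct)
  case (less n)
  show ?case
  proof (cases n)
    case 0
    then show ?thesis
      using less.prems id_in_product_closure by (simp del: id_apply)
  next
    case (Suc n')
    then obtain s h where g: "g = s \<circ> h" "s \<in> simple" "h \<in> products simple n'"
      using less.prems by auto
    have "s \<in> T"
      using g simple_subset by blast
    have "h \<in> product_closure simple"
      using g unfolding product_closure_def by blast
    then have h: "h \<in> product_closure T"
      using simple_closure_subset by blast
    show ?thesis
    proof (cases "separates s p (h p)")
      \<comment> \<open>The word is not reduced: by exchange, \<open>s \<circ> h\<close> also has a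
        word shorter than that of \<open>h\<close>.\<close>
      case True
      then obtain m where "m < n'" "g \<in> products simple m"
        using exchange[OF \<open>s \<in> T\<close> g(3)] g(1) by blast
      then show ?thesis
        using less Suc by (meson less_SucI)
    next
      case False
      have "s \<circ> s \<circ> s = s"
        by (auto simp: involution \<open>s \<in> T\<close>)
      then have sep: "separates s p (g p)"
        using separates_simple_comp[OF g(2) \<open>s \<in> T\<close> h] False g(1) by simp
      \<comment> \<open>Group elements carry mirrors to mirrors, so \<open>g' v\<close> stays in the
        closure of the chamber of \<open>g' p\<close>.\<close>
      have closed: "\<not> separates t (g' p) (g' v)" if "g' \<in> product_closure T" "t \<in> T" for g' t
        using that
      proof (induction arbitrary: t rule: product_closure_induct)
        case (comp s' g')
        then show ?case
          using separates_image_iff[of s' t] conjugate[of s' t] by (metis comp_apply)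
      qed (use assms(3) in simp)
      \<comment> \<open>As \<open>g v = v\<close>, the point \<open>v\<close> is in the closure of
        both chambers. The mirror of \<open>s\<close> has \<open>p\<close> and \<open>g p\<close> on
        opposite sides, so \<open>v\<close> must lie on it.\<close>
      have "\<not> separates s (g p) v"
        using closed[of g s] less.prems g(1) h \<open>s \<in> T\<close> comp_in_product_closure by metis
      moreover have "\<not> separates s p v"
        using assms(3) \<open>s \<in> T\<close> .
      moreover obtain u c where u: "norm u = 1" "s = affine_reflection u c" "p \<bullet> u - c > 0"
        using oriented_reflection \<open>s \<in> T\<close> generic_base by blast
      ultimately have "v \<bullet> u - c = 0"
        using sep unfolding u(2) separates_affine_reflection_iff[OF u(1)]
        by (auto simp: mult_less_0_iff)
      then have "s v = v"
        using affine_reflection_fixed_iff[OF u(1)] u(2) by simp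
      then have "h v = v"
        using less.prems(2) g(1) involution[OF \<open>s \<in> T\<close>] by (metis comp_apply)
      then have "h \<in> product_closure {t \<in> T. t v = v}"
        using less.IH g(3) Suc by blast
      then show ?thesis
        unfolding g(1) using \<open>s v = v\<close> \<open>s \<in> T\<close> by (intro comp_in_product_closure) simp
    qed
  qed
qed

end

section \<open>Stabilizers of arbitrary points\<close>

context reflection_arrangement
begin

lemma stabilizer_generated:
  assumes "g \<in> product_closure T" "g v = v"
  shows "g \<in> product_closure {t \<in> T. t v = v}"
proof -
  \<comment> \<open>The cutoff 1 makes the set finite. Inserting 1 before taking the minimum keeps
    it nonempty and bounds the discarded displacements, so \<open>\<delta>\<close> bounds below
    every nonzero displacement of \<open>v\<close>.\<close>
  define D where "D = (\<lambda>t. dist v (t v)) ` {t \<in> T. dist v (t v) \<le> 1 \<and> t v \<noteq> v}"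
  define \<delta> where "\<delta> = Min (insert 1 D)"
  have "finite {t \<in> T. dist v (t v) \<le> 1 \<and> t v \<noteq> v}"
    by (rule finite_subset[OF _ locally_finite[of v 1]]) auto
  then have "finite D"
    by (simp add: D_def)
  then have "\<delta> > 0"
    by (auto simp: \<delta>_def D_def)
  have \<delta>: "dist v (t v) \<ge> \<delta>" if "t \<in> T" "t v \<noteq> v" for t
  proof (cases "dist v (t v) \<le> 1")
    case True
    then have "dist v (t v) \<in> D"
      using that by (auto simp: D_def)
    then show ?thesis
      using \<open>finite D\<close> by (simp add: \<delta>_def)
  next
    case False
    moreover have "\<delta> \<le> 1"
      using \<open>finite D\<close> by (simp add: \<delta>_def)
    ultimately show ?thesis
      by simp
  qed
  obtain p where p: "generic p" "dist p v < \<delta> / 2"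
    using exists_generic[of "\<delta> / 2" v] \<open>\<delta> > 0\<close> by auto
  interpret based_reflection_arrangement T p
    by unfold_locales (rule p)
  \<comment> \<open>A mirror through \<open>v\<close> leaves the distance to \<open>v\<close>
    unchanged; any other moves \<open>p\<close> to distance more than \<open>\<delta> / 2\<close>
    from \<open>v\<close>, while \<open>p\<close> is closer than that.\<close>
  have "\<not> separates t p v" if "t \<in> T" for t
  proof (cases "t v = v")
    case True
    then show ?thesis
      using isometry[OF that, of p v] by (simp add: separates_def)
  next
    case False
    then have "\<delta> \<le> dist v (t v)"
      using \<delta> that by blast
    also have "\<dots> \<le> dist (t p) v + dist p v"
      using dist_triangle2[of v "t v" "t p"] isometry[OF that, of p v] by (simp add: dist_commute)
    finally show ?thesis
      using p by (simp add: separates_def)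
  qed
  moreover have "g \<in> product_closure simple"
    using assms(1) product_closure_subset reflection_in_simple_closure by blast
  ultimately show ?thesis
    using stabilizer_generated_near assms(2) by (auto simp: product_closure_def)
qed

end

section \<open>The affine reflections of a root lattice\<close>

lemma root_reflection_add: "root_reflection r (x + y) = root_reflection r x + root_reflection r y"
  by (simp add: root_reflection_def inner_add_left add_divide_distrib algebra_simps)

lemma root_reflection_scaleR: "root_reflection r (c *\<^sub>R x) = c *\<^sub>R root_reflection r x"
  by (simp add: root_reflection_def algebra_simps)

lemma linear_root_reflection: "linear (root_reflection r)"
  by (rule linearI) (rule root_reflection_add, rule root_reflection_scaleR)

lemmas root_reflection_diff = linear_diff[OF linear_root_reflection]

lemma root_reflection_self: "root_reflection r r = - r"
  by (simp add: root_reflection_def scaleR_2)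

lemma root_reflection_uminus: "root_reflection (- r) = root_reflection r"
  by (simp add: root_reflection_def fun_eq_iff)

lemma root_reflection_involution: "root_reflection r (root_reflection r x) = x"
proof (cases "r = 0")
  case False
  then show ?thesis
    by (simp add: root_reflection_def inner_diff_left algebra_simps)
qed (simp add: root_reflection_def)

lemma inner_root_reflection_left: "root_reflection r x \<bullet> y = x \<bullet> root_reflection r y"
  by (simp add: root_reflection_def inner_diff_left inner_diff_right inner_commute)

text \<open>A root reflection is linear, involutive and self-adjoint, hence an isometry, so it
  carries the mirror of \<open>s\<close> to that of its image.\<close>

lemma root_reflection_root_reflection:
  "root_reflection (root_reflection r s) x = root_reflection r (root_reflection s (root_reflection r x))"
proof -
  have "root_reflection r s \<bullet> root_reflection r s = s \<bullet> s"
    by (simp add: inner_root_reflection_left root_reflection_involution)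
  then show ?thesis
    by (simp add: root_reflection_def[of "root_reflection r s"] root_reflection_def[of s]
        root_reflection_diff root_reflection_scaleR root_reflection_involution
        inner_root_reflection_left)
qed

text \<open>This links the subgroup generated in the group of bijections with words under
  composition: an involution is its own inverse.\<close>

lemma generate_involutions:
  assumes "\<And>s x. s \<in> S \<Longrightarrow> s (s x) = x"
  shows "generate (BijGroup UNIV) S = product_closure S"
proof -
  interpret group "BijGroup UNIV :: ('a \<Rightarrow> 'a) monoid"
    by (rule group_BijGroup)
  have carrier: "f \<in> carrier (BijGroup UNIV) \<longleftrightarrow> bij f" for f :: "'a \<Rightarrow> 'a"
    by (simp add: BijGroup_def Bij_def)
  have one: "\<one>\<^bsub>BijGroup UNIV\<^esub> = (id :: 'a \<Rightarrow> 'a)"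
    by (simp add: BijGroup_def fun_eq_iff)
  have mult: "f \<otimes>\<^bsub>BijGroup UNIV\<^esub> g = f \<circ> g" if "bij f" "bij g" for f g :: "'a \<Rightarrow> 'a"
    using that by (simp add: BijGroup_def Bij_def compose_def fun_eq_iff)
  have bij_S: "bij s" if "s \<in> S" for s
    using assms[OF that] by (rule involuntory_imp_bij)
  have inv: "inv\<^bsub>BijGroup UNIV\<^esub> s = s" if "s \<in> S" for s
  proof (rule inv_equality)
    have "s \<circ> s = id"
      using assms[OF that] by (simp add: fun_eq_iff)
    then show "s \<otimes>\<^bsub>BijGroup UNIV\<^esub> s = \<one>\<^bsub>BijGroup UNIV\<^esub>"
      using mult bij_S that one by metis
  qed (use bij_S that carrier in blast)+
  have bij_closure: "bij g" if "g \<in> product_closure S" for g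
    using that by (induction rule: product_closure_induct) (use bij_S bij_comp bij_id in blast)+
  show ?thesis
  proof (intro equalityI subsetI)
    fix g assume "g \<in> generate (BijGroup UNIV) S"
    then show "g \<in> product_closure S"
    proof induction
      case (eng h1 h2)
      then show ?case
        using mult bij_closure product_closure_comp by metis
    qed (use one inv id_in_product_closure incl_product_closure in metis)+
  next
    fix g assume "g \<in> product_closure S"
    then show "g \<in> generate (BijGroup UNIV) S"
    proof (induction rule: product_closure_induct)
      case id
      show ?case
        using generate.one one by metis
    next
      case (comp s g)
      then show ?case
        using mult bij_S bij_closure generate.eng generate.incl by metis
    qed
  qed
qed

lemma weyl_group_eq_product_closure: "weyl_group R = product_closure (root_reflection ` R)"
  unfolding weyl_group_def
  by (rule generate_involutions) (auto simp: root_reflection_involution)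

section \<open>The root lattice\<close>

interpretation int_module: module "\<lambda>(n::int) (x::'a::euclidean_space). of_int n *\<^sub>R x"
  by (rule module_of_int_scaleR)

lemma root_in_root_lattice: "r \<in> R \<Longrightarrow> r \<in> root_lattice R"
  unfolding root_lattice_def by (rule int_module.span_base)

lemma root_lattice_zero: "0 \<in> root_lattice R"
  unfolding root_lattice_def by (rule int_module.span_zero)

lemma root_lattice_add: "x \<in> root_lattice R \<Longrightarrow> y \<in> root_lattice R \<Longrightarrow> x + y \<in> root_lattice R"
  unfolding root_lattice_def by (rule int_module.span_add)

lemma root_lattice_diff: "x \<in> root_lattice R \<Longrightarrow> y \<in> root_lattice R \<Longrightarrow> x - y \<in> root_lattice R"
  unfolding root_lattice_def by (rule int_module.span_diff)

lemma root_lattice_uminus: "x \<in> root_lattice R \<Longrightarrow> - x \<in> root_lattice R"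
  unfolding root_lattice_def by (rule int_module.span_neg)

lemma root_lattice_scale: "x \<in> root_lattice R \<Longrightarrow> of_int n *\<^sub>R x \<in> root_lattice R"
  unfolding root_lattice_def by (rule int_module.span_scale)

lemma root_lattice_induct [consumes 1, case_names zero add]:
  assumes "x \<in> root_lattice R" "P 0"
    and "\<And>n r y. r \<in> R \<Longrightarrow> P y \<Longrightarrow> P (of_int n *\<^sub>R r + y)"
  shows "P x"
  using int_module.span_induct_alt[of x R P] assms unfolding root_lattice_def by blast

text \<open>For nonzero \<open>r\<close> the mirror is the hyperplane
  \<open>2 * (x \<bullet> r) / (r \<bullet> r) = c\<close>. The form displays the linear part and
  the translation separately.\<close>

definition affine_root_reflection :: "'a::euclidean_space \<Rightarrow> real \<Rightarrow> 'a \<Rightarrow> 'a" where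
  "affine_root_reflection r c x = root_reflection r x + c *\<^sub>R r"

section \<open>The affine reflection arrangement of a root system\<close>

locale root_system_locale =
  fixes R :: "'a::euclidean_space set"
  assumes root_system: "root_system R"
begin

lemma finite_roots: "finite R"
  and root_nonzero: "r \<in> R \<Longrightarrow> r \<noteq> 0"
  and root_reflection_root: "r \<in> R \<Longrightarrow> s \<in> R \<Longrightarrow> root_reflection r s \<in> R"
  and crystallographic: "r \<in> R \<Longrightarrow> s \<in> R \<Longrightarrow> 2 * (s \<bullet> r) / (r \<bullet> r) \<in> \<int>"
  and span_root: "r \<in> R \<Longrightarrow> span {r} \<inter> R = {r, - r}"
  using root_system unfolding root_system_def by blast+

lemma root_lattice_crystallographic:
  assumes "r \<in> R" "x \<in> root_lattice R"
  shows "2 * (x \<bullet> r) / (r \<bullet> r) \<in> \<int>"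
  using assms(2)
proof (induction rule: root_lattice_induct)
  case (add n s y)
  have "2 * ((of_int n *\<^sub>R s + y) \<bullet> r) / (r \<bullet> r)
      = of_int n * (2 * (s \<bullet> r) / (r \<bullet> r)) + 2 * (y \<bullet> r) / (r \<bullet> r)"
    by (simp add: inner_add_left add_divide_distrib distrib_left)
  then show ?case
    using add crystallographic[OF assms(1)] by (metis Ints_add Ints_mult Ints_of_int)
qed simp

lemma root_reflection_root_lattice:
  assumes "r \<in> R" "x \<in> root_lattice R"
  shows "root_reflection r x \<in> root_lattice R"
proof -
  obtain n where "2 * (x \<bullet> r) / (r \<bullet> r) = of_int n"
    using root_lattice_crystallographic assms Ints_cases by metis
  then show ?thesis
    using assms root_lattice_diff root_lattice_scale root_in_root_lattice
    unfolding root_reflection_def by metis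
qed

(* The condition on c makes these the reflections of the affine group generated by the Weyl
   group and the translations by the root lattice. *)
definition affine_reflections :: "('a \<Rightarrow> 'a) set" where
  "affine_reflections = {affine_root_reflection r c | r c. r \<in> R \<and> c *\<^sub>R r \<in> root_lattice R}"

lemma affine_root_reflection_eq:
  assumes "r \<noteq> 0"
  shows "affine_root_reflection r c = affine_reflection (sgn r) (c * norm r / 2)"
proof
  fix x
  have "affine_reflection (sgn r) (c * norm r / 2) x
      = x - (2 * (x \<bullet> sgn r) - c * norm r) *\<^sub>R sgn r"
    by (simp add: affine_reflection_def)
  also have "\<dots> = x - (2 * (x \<bullet> r) / (norm r * norm r) - c) *\<^sub>R r"
    using assms by (simp add: sgn_div_norm field_simps)
  finally show "affine_root_reflection r c x = affine_reflection (sgn r) (c * norm r / 2) x"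
    by (simp add: affine_root_reflection_def root_reflection_def algebra_simps
        power2_norm_eq_inner flip: power2_eq_square)
qed

lemma affine_reflections_conjugate:
  assumes "s \<in> affine_reflections" "t \<in> affine_reflections"
  shows "s \<circ> t \<circ> s \<in> affine_reflections"
proof -
  obtain r c where s: "s = affine_root_reflection r c" "r \<in> R" "c *\<^sub>R r \<in> root_lattice R"
    using assms by (auto simp: affine_reflections_def)
  obtain r' c' where t: "t = affine_root_reflection r' c'" "r' \<in> R" "c' *\<^sub>R r' \<in> root_lattice R"
    using assms by (auto simp: affine_reflections_def)
  define m where "m = 2 * (r \<bullet> r') / (r' \<bullet> r')"
  have r: "root_reflection r' r = r - m *\<^sub>R r'"
    by (simp add: root_reflection_def m_def)
  have "s \<circ> t \<circ> s = affine_root_reflection (root_reflection r r') (c' - c * m)"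
    by (simp add: fun_eq_iff s(1) t(1) affine_root_reflection_def root_reflection_add
        root_reflection_scaleR root_reflection_diff r root_reflection_self
        root_reflection_root_reflection algebra_simps)
  moreover have "(c' - c * m) *\<^sub>R root_reflection r r' \<in> root_lattice R"
  proof -
    \<comment> \<open>The bracket equals \<open>- (c * m) *\<^sub>R r'\<close> and is a lattice
      vector because \<open>root_reflection r'\<close> preserves the lattice.\<close>
    have "(c' - c * m) *\<^sub>R r' = c' *\<^sub>R r' + (root_reflection r' (c *\<^sub>R r) - c *\<^sub>R r)"
      by (simp add: root_reflection_scaleR r algebra_simps)
    also have "\<dots> \<in> root_lattice R"
      using s t by (intro root_lattice_add root_lattice_diff root_reflection_root_lattice)
    finally show ?thesis
      using root_reflection_root_lattice s by (metis root_reflection_scaleR)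
  qed
  ultimately show ?thesis
    using root_reflection_root s t unfolding affine_reflections_def by blast
qed

text \<open>Pairing the lattice vector \<open>c *\<^sub>R r\<close> with \<open>r\<close> itself
  shows that \<open>2 * c\<close> is an integer, and a bounded displacement of \<open>x\<close>
  bounds it. Each of the finitely many roots thus contributes finitely many reflections.\<close>

lemma affine_reflections_locally_finite: "finite {t \<in> affine_reflections. dist x (t x) \<le> d}"
proof -
  define k where "k r = 2 * (x \<bullet> r) / (r \<bullet> r)" for r
  define B where "B r = 2 * (\<bar>k r\<bar> + d / norm r)" for r
  have "{t \<in> affine_reflections. dist x (t x) \<le> d}
      \<subseteq> (\<Union>r\<in>R. (\<lambda>m. affine_root_reflection r (m / 2)) ` {m \<in> \<int>. \<bar>m\<bar> \<le> B r})"
  proof clarify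
    fix t assume "t \<in> affine_reflections" and d: "dist x (t x) \<le> d"
    then obtain r c where t: "t = affine_root_reflection r c" "r \<in> R" "c *\<^sub>R r \<in> root_lattice R"
      by (auto simp: affine_reflections_def)
    have "norm r > 0"
      using root_nonzero t by simp
    have "2 * c \<in> \<int>"
      using root_lattice_crystallographic[OF t(2,3)] \<open>norm r > 0\<close> by simp
    have "x - t x = (k r - c) *\<^sub>R r"
      by (simp add: t(1) affine_root_reflection_def root_reflection_def k_def algebra_simps)
    then have "\<bar>k r - c\<bar> * norm r \<le> d"
      using d by (simp add: dist_norm)
    then have "\<bar>k r - c\<bar> \<le> d / norm r"
      using \<open>norm r > 0\<close> by (simp add: pos_le_divide_eq)
    moreover have "\<bar>c\<bar> \<le> \<bar>k r\<bar> + \<bar>k r - c\<bar>"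
      by arith
    ultimately have "\<bar>2 * c\<bar> \<le> B r"
      unfolding B_def abs_mult by simp
    then show "t \<in> (\<Union>r\<in>R. (\<lambda>m. affine_root_reflection r (m / 2)) ` {m \<in> \<int>. \<bar>m\<bar> \<le> B r})"
      using t \<open>2 * c \<in> \<int>\<close> by (intro UN_I[of r] image_eqI[of _ _ "2 * c"]) auto
  qed
  then show ?thesis
    by (rule finite_subset) (use finite_roots finite_abs_int_segment in auto)
qed

sublocale reflection_arrangement affine_reflections
proof
  fix t assume "t \<in> affine_reflections"
  then show "\<exists>u c. norm u = 1 \<and> t = affine_reflection u c"
    using root_nonzero affine_root_reflection_eq norm_sgn
    unfolding affine_reflections_def by (smt (verit) mem_Collect_eq)
qed (rule affine_reflections_conjugate affine_reflections_locally_finite; assumption?)+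

lemma linear_reflection_in_affine_reflections:
  assumes "r \<in> R"
  shows "root_reflection r \<in> affine_reflections"
proof -
  have "root_reflection r = affine_root_reflection r 0"
    by (simp add: affine_root_reflection_def fun_eq_iff)
  then show ?thesis
    using assms root_lattice_zero unfolding affine_reflections_def by force
qed

text \<open>Translation by an integer multiple of a root is a product of two reflections in parallel
  mirrors.\<close>

lemma translate_in_closure:
  assumes "g \<in> product_closure affine_reflections" "y \<in> root_lattice R"
  shows "(\<lambda>x. g x + y) \<in> product_closure affine_reflections"
  using assms(2)
proof (induction rule: root_lattice_induct)
  case zero
  then show ?case
    using assms(1) by simp
next
  case (add n r y)
  have "affine_root_reflection r (of_int n) \<in> affine_reflections"
    using add root_lattice_scale root_in_root_lattice unfolding affine_reflections_def by blast
  then have "affine_root_reflection r (of_int n) \<circ> (root_reflection r \<circ> (\<lambda>x. g x + y))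
      \<in> product_closure affine_reflections"
    using add linear_reflection_in_affine_reflections by (intro comp_in_product_closure)
  also have "affine_root_reflection r (of_int n) \<circ> (root_reflection r \<circ> (\<lambda>x. g x + y))
      = (\<lambda>x. g x + (of_int n *\<^sub>R r + y))"
    by (simp add: affine_root_reflection_def fun_eq_iff root_reflection_involution)
  finally show ?case .
qed

lemma linear_weyl_group:
  assumes "\<rho> \<in> weyl_group R"
  shows "linear \<rho>"
  using assms unfolding weyl_group_eq_product_closure
  by (induction rule: product_closure_induct)
    (use linear_id linear_compose linear_root_reflection in blast)+

lemma weyl_group_root_lattice:
  assumes "\<rho> \<in> weyl_group R" "x \<in> root_lattice R"
  shows "\<rho> x \<in> root_lattice R"
  using assms unfolding weyl_group_eq_product_closure
  by (induction rule: product_closure_induct) (auto intro: root_reflection_root_lattice)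

lemma weyl_group_subset_closure: "weyl_group R \<subseteq> product_closure affine_reflections"
  unfolding weyl_group_eq_product_closure
  by (rule product_closure_subset)
    (use linear_reflection_in_affine_reflections incl_product_closure in blast)

section \<open>The coset stabilizer and its roots\<close>

lemma id_in_stabilizer: "id \<in> weyl_coset_stabilizer R v"
  unfolding weyl_coset_stabilizer_def weyl_group_eq_product_closure 
  using id_in_product_closure[of "root_reflection ` R"] root_lattice_zero[of R]
  by (metis (mono_tags, lifting) diff_self id_apply mem_Collect_eq)

lemma stabilizer_comp:
  assumes "g \<in> weyl_coset_stabilizer R v" "h \<in> weyl_coset_stabilizer R v"
  shows "g \<circ> h \<in> weyl_coset_stabilizer R v"
proof -
  have "linear g"
    using assms linear_weyl_group by (simp add: weyl_coset_stabilizer_def)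
  then have "(g \<circ> h) v - v = g (h v - v) + (g v - v)"
    by (simp add: linear_diff)
  also have "\<dots> \<in> root_lattice R"
    using assms unfolding weyl_coset_stabilizer_def
    by (blast intro: weyl_group_root_lattice root_lattice_add)
  finally show ?thesis
    using assms product_closure_comp
    unfolding weyl_coset_stabilizer_def weyl_group_eq_product_closure by blast
qed

definition integral_roots :: "'a \<Rightarrow> 'a set" where
  "integral_roots v = {r \<in> R. root_reflection r \<in> weyl_coset_stabilizer R v}"

lemma integral_roots_iff:
  "r \<in> integral_roots v \<longleftrightarrow> r \<in> R \<and> root_reflection r v - v \<in> root_lattice R"
proof -
  have "root_reflection r \<in> weyl_group R" if "r \<in> R"
    unfolding weyl_group_eq_product_closure using that by (intro incl_product_closure imageI)
  then show ?thesis
    unfolding integral_roots_def weyl_coset_stabilizer_def by blast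
qed

text \<open>Closure under reflections comes from conjugation: the reflection in
  \<open>root_reflection r s\<close> is a product of three elements of the stabilizer, which is
  closed under composition. The other axioms are inherited from \<open>R\<close>.\<close>

lemma root_system_integral_roots: "root_system (integral_roots v)"
proof -
  have "integral_roots v \<subseteq> R"
    by (auto simp: integral_roots_def)
  have closed: "root_reflection r s \<in> integral_roots v"
    if "r \<in> integral_roots v" "s \<in> integral_roots v" for r s
  proof -
    have "root_reflection r \<circ> (root_reflection s \<circ> root_reflection r) \<in> weyl_coset_stabilizer R v"
      using that unfolding integral_roots_def by (blast intro: stabilizer_comp)
    moreover have "root_reflection (root_reflection r s)
        = root_reflection r \<circ> (root_reflection s \<circ> root_reflection r)"
      by (simp add: fun_eq_iff root_reflection_root_reflection)
    ultimately show ?thesis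
      using that root_reflection_root by (simp add: integral_roots_def)
  qed
  have "root_reflection r ` integral_roots v = integral_roots v" if "r \<in> integral_roots v" for r
  proof
    show "integral_roots v \<subseteq> root_reflection r ` integral_roots v"
      using closed[OF that] root_reflection_involution by (metis image_eqI subsetI)
  qed (use closed[OF that] in blast)
  moreover have "span {r} \<inter> integral_roots v = {r, - r}" if r: "r \<in> integral_roots v" for r
  proof -
    have "span {r} \<inter> R = {r, - r}"
      using r \<open>integral_roots v \<subseteq> R\<close> span_root by blast
    moreover from this have "- r \<in> integral_roots v"
      using r by (auto simp: integral_roots_def root_reflection_uminus)
    ultimately show ?thesis
      using r \<open>integral_roots v \<subseteq> R\<close> by blast
  qed
  moreover have "finite (integral_roots v)"
    using \<open>integral_roots v \<subseteq> R\<close> finite_roots finite_subset by blast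
  moreover have "0 \<notin> integral_roots v"
    using \<open>integral_roots v \<subseteq> R\<close> root_nonzero by blast
  moreover have "2 * (s \<bullet> r) / (r \<bullet> r) \<in> \<int>"
    if "r \<in> integral_roots v" "s \<in> integral_roots v" for r s
    using that \<open>integral_roots v \<subseteq> R\<close> by (intro crystallographic) auto
  ultimately show ?thesis
    unfolding root_system_def by simp
qed

(* The roots of the affine reflections fixing v are integral on v, so the linear parts of
   the products of these reflections lie in the Weyl group of the integral roots. *)
lemma stabilizer_subset:
  assumes "\<rho> \<in> weyl_coset_stabilizer R v"
  shows "\<rho> \<in> weyl_group (integral_roots v)"
proof -
  have \<rho>: "\<rho> \<in> weyl_group R" "v - \<rho> v \<in> root_lattice R"
    using assms root_lattice_uminus by (fastforce simp: weyl_coset_stabilizer_def)+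
  \<comment> \<open>This map has linear part \<open>\<rho>\<close>, fixes \<open>v\<close>, and
    differs from \<open>\<rho>\<close> by a lattice translation.\<close>
  define g where "g = (\<lambda>x. \<rho> x + (v - \<rho> v))"
  have "g \<in> product_closure affine_reflections"
    unfolding g_def using \<rho> weyl_group_subset_closure by (intro translate_in_closure) auto
  moreover have "g v = v"
    by (simp add: g_def)
  ultimately have "g \<in> product_closure {t \<in> affine_reflections. t v = v}"
    by (rule stabilizer_generated)
  then have "\<exists>\<rho>'\<in>weyl_group (integral_roots v). \<exists>y. \<forall>x. g x = \<rho>' x + y"
  proof (induction rule: product_closure_induct)
    case id
    show ?case
      unfolding weyl_group_eq_product_closure
      by (rule bexI[OF _ id_in_product_closure]) (auto intro: exI[of _ 0])
  next
    case (comp t g)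
    then obtain \<rho>' y where \<rho>': "\<rho>' \<in> weyl_group (integral_roots v)" "\<And>x. g x = \<rho>' x + y"
      by blast
    obtain r c where t: "t = affine_root_reflection r c" "r \<in> R" "c *\<^sub>R r \<in> root_lattice R"
      and "t v = v"
      using comp by (auto simp: affine_reflections_def)
    \<comment> \<open>Fixing \<open>v\<close> forces the translation part of \<open>t\<close> to be
      \<open>v - root_reflection r v\<close>, which is therefore a lattice vector.\<close>
    then have "root_reflection r v - v = - (c *\<^sub>R r)"
      by (simp add: affine_root_reflection_def algebra_simps eq_neg_iff_add_eq_0)
    then have "r \<in> integral_roots v"
      using t root_lattice_uminus by (simp add: integral_roots_iff)
    then have "root_reflection r \<circ> \<rho>' \<in> weyl_group (integral_roots v)"
      using \<rho>'(1) comp_in_product_closure unfolding weyl_group_eq_product_closure by blast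
    moreover have "(t \<circ> g) x = (root_reflection r \<circ> \<rho>') x + (root_reflection r y + c *\<^sub>R r)" for x
      by (simp add: t(1) affine_root_reflection_def \<rho>'(2) root_reflection_add)
    ultimately show ?case
      by blast
  qed
  then obtain \<rho>' y where \<rho>': "\<rho>' \<in> weyl_group (integral_roots v)" "\<And>x. g x = \<rho>' x + y"
    by blast
  have "linear \<rho>'"
    using root_system_locale.linear_weyl_group[OF _ \<rho>'(1)] root_system_integral_roots
    by (simp add: root_system_locale_def)
  \<comment> \<open>Evaluating both affine expressions for \<open>g\<close> at 0 identifies the
    translations, and hence the linear parts.\<close>
  then have "y = v - \<rho> v"
    using \<rho>'(2)[of 0] linear_weyl_group[OF \<rho>(1)] by (simp add: g_def linear_0)
  then have "\<rho> = \<rho>'"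
    using \<rho>'(2) by (simp add: g_def fun_eq_iff)
  then show ?thesis
    using \<rho>'(1) by simp
qed

lemma stabilizer_eq: "weyl_coset_stabilizer R v = weyl_group (integral_roots v)"
proof (intro equalityI subsetI)
  fix g assume "g \<in> weyl_group (integral_roots v)"
  then show "g \<in> weyl_coset_stabilizer R v"
    unfolding weyl_group_eq_product_closure
  proof (induction rule: product_closure_induct)
    case (comp s g)
    then show ?case
      using stabilizer_comp unfolding integral_roots_def by blast
  qed (rule id_in_stabilizer)
qed (rule stabilizer_subset)

end

theorem theorem2p1:
  fixes R :: "'a::euclidean_space set" and v :: 'a
  assumes "root_system R"
    and "v \<in> span (root_lattice R)"
  shows "root_system {r \<in> R. root_reflection r \<in> weyl_coset_stabilizer R v}
    \<and> weyl_coset_stabilizer R v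
        = weyl_group {r \<in> R. root_reflection r \<in> weyl_coset_stabilizer R v}"
proof -
  interpret root_system_locale R
    by unfold_locales (rule assms(1))
  show ?thesis
    using root_system_integral_roots stabilizer_eq unfolding integral_roots_def by blast
qed

end
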